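(* Let $\langle A;\cdot,0,\Diamond\rangle$ be a monadic quasi-implication algebra and let $\mathfrak{F}(A)$ be the set of proper filters of the bounded quasi-implication algebra $\langle A;\cdot,0\rangle$. Define $\alpha\perp^G_A\beta$ iff there exists $x\in A$ with $x\in\alpha$ and $x\cdot 0\in\beta$, and $\alpha R^G_A\beta$ iff $\Diamond[\alpha]\subseteq\beta$, where $\Diamond[\alpha]=\{\Diamond x: x\in\alpha\}$. Then $\langle\mathfrak{F}(A);\perp^G_A,R^G_A\rangle$ is a monadic orthoframe.
   Context: A quasi-implication algebra is a magma $\langle A;\cdot\rangle$ satisfying, for all $x,y,z$: (1) $(x\cdot y)\cdot x=x$; (2) $(x\cdot y)\cdot(x\cdot z)=(y\cdot x)\cdot(y\cdot z)$; (3) $((x\cdot y)\cdot(y\cdot x))\cdot x=((y\cdot x)\cdot(x\cdot y))\cdot y$. In any quasi-implication algebra $x\cdot x=y\cdot y$ for all $x,y$, and $1$ denotes this common element. A bounded quasi-implication algebra is a quasi-implication algebra with a distinguished element $0$ such that $0\cdot x=1$ for all $x$. A monadic quasi-implication algebra is an algebra $\langle A;\cdot,0,\Diamond\rangle$ such that $\langle A;\cdot,0\rangle$ is a bounded quasi-implication algebra and $\Diamond\colon A\to A$ satisfies, for all $x,y$: (a) $\Diamond\Diamond x\cdot\Diamond x=1$ and $x\cdot\Diamond x=1$; (b) $\Diamond(\Diamond x\cdot 0)=\Diamond x\cdot 0$ and $\Diamond 0=0$; (c) $\Diamond(((x\cdot 0)\cdot(y\cdot 0))\cdot x)=((\Diamond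 x\cdot 0)\cdot(\Diamond y\cdot 0))\cdot\Diamond x$. A filter of a bounded quasi-implication algebra $A$ is a non-empty subset $\alpha\subseteq A$ such that (i) if $x\in\alpha$ and $x\cdot y=1$ then $y\in\alpha$; (ii) if $x,y\in\alpha$ then $((x\cdot y)\cdot(x\cdot 0))\cdot 0\in\alpha$; it is proper if $0\notin\alpha$. For a relation $R$ on a set $X$ and $U\subseteq X$, $R[U]=\{y\in X: uRy\text{ for some }u\in U\}$; for a relation $\perp$ on $X$, $U^{\perp}=\{y\in X: y\perp u\text{ for all }u\in U\}$. A monadic orthoframe is a triple $\langle X;\perp,R\rangle$ where $\perp$ is an irreflexive symmetric relation on $X$, $R$ is a reflexive transitive relation on $X$, and $R[R[\{x\}]^{\perp}]\subseteq R[\{x\}]^{\perp}$ for all $x\in X$. *)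

theory Defs
  imports Main
begin

locale quasi_implication_algebra =
  fixes A :: "'a set"
    and imp :: "'a \<Rightarrow> 'a \<Rightarrow> 'a" (infixl "\<cdot>" 70)
  assumes imp_closed: "\<lbrakk>x \<in> A; y \<in> A\<rbrakk> \<Longrightarrow> x \<cdot> y \<in> A"
    and QI1: "\<lbrakk>x \<in> A; y \<in> A\<rbrakk> \<Longrightarrow> (x \<cdot> y) \<cdot> x = x"
    and QI2: "\<lbrakk>x \<in> A; y \<in> A; z \<in> A\<rbrakk> \<Longrightarrow>
      (x \<cdot> y) \<cdot> (x \<cdot> z) = (y \<cdot> x) \<cdot> (y \<cdot> z)"
    and QI3: "\<lbrakk>x \<in> A; y \<in> A\<rbrakk> \<Longrightarrow>
      ((x \<cdot> y) \<cdot> (y \<cdot> x)) \<cdot> x = ((y \<cdot> x) \<cdot> (x \<cdot> y)) \<cdot> y"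
begin

lemma self_imp_eq:
  assumes "x \<in> A" "y \<in> A"
  shows "x \<cdot> x = y \<cdot> y"
  using assms QI1 QI2 QI3 imp_closed by (smt (verit, ccfv_SIG))

text \<open>Meaningful when the carrier is non-empty, by the preceding lemma.\<close>

definition one :: "'a" ("\<one>")
  where "\<one> = (THE u. \<forall>x\<in>A. x \<cdot> x = u)"

lemma self_imp: "x \<in> A \<Longrightarrow> x \<cdot> x = \<one>"
  unfolding one_def by (rule theI2[where a = "x \<cdot> x"]) (auto intro: self_imp_eq)

end

locale bounded_quasi_implication_algebra = quasi_implication_algebra A imp
  for A :: "'a set" and imp :: "'a \<Rightarrow> 'a \<Rightarrow> 'a" (infixl "\<cdot>" 70) +
  fixes zero :: "'a" ("\<zero>")
  assumes zero_closed: "\<zero> \<in> A"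
    and zero_imp: "x \<in> A \<Longrightarrow> \<zero> \<cdot> x = \<one>"
begin

definition filters :: "'a set set"
  where "filters = {\<alpha>. \<alpha> \<subseteq> A \<and> \<alpha> \<noteq> {} \<and>
    (\<forall>x\<in>\<alpha>. \<forall>y\<in>A. x \<cdot> y = \<one> \<longrightarrow> y \<in> \<alpha>) \<and>
    (\<forall>x\<in>\<alpha>. \<forall>y\<in>\<alpha>. ((x \<cdot> y) \<cdot> (x \<cdot> \<zero>)) \<cdot> \<zero> \<in> \<alpha>)}"

definition proper_filters :: "'a set set"
  where "proper_filters = {\<alpha> \<in> filters. \<zero> \<notin> \<alpha>}"

definition filter_perp :: "('a set \<times> 'a set) set"
  where "filter_perp = {(\<alpha>, \<beta>) \<in> proper_filters \<times> proper_filters.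
    \<exists>x\<in>A. x \<in> \<alpha> \<and> x \<cdot> \<zero> \<in> \<beta>}"

end

locale monadic_quasi_implication_algebra = bounded_quasi_implication_algebra A imp zero
  for A :: "'a set" and imp :: "'a \<Rightarrow> 'a \<Rightarrow> 'a" (infixl "\<cdot>" 70)
    and zero :: "'a" ("\<zero>") +
  fixes dia :: "'a \<Rightarrow> 'a" ("\<diamond> _" [90] 90)
  assumes dia_closed: "x \<in> A \<Longrightarrow> \<diamond> x \<in> A"
    and dia_dia: "x \<in> A \<Longrightarrow> \<diamond> \<diamond> x \<cdot> \<diamond> x = \<one>"
    and imp_dia: "x \<in> A \<Longrightarrow> x \<cdot> \<diamond> x = \<one>"
    and dia_compl: "x \<in> A \<Longrightarrow> \<diamond> (\<diamond> x \<cdot> \<zero>) = \<diamond> x \<cdot> \<zero>"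
    and dia_zero: "\<diamond> \<zero> = \<zero>"
    and dia_join: "\<lbrakk>x \<in> A; y \<in> A\<rbrakk> \<Longrightarrow>
      \<diamond> (((x \<cdot> \<zero>) \<cdot> (y \<cdot> \<zero>)) \<cdot> x) =
        ((\<diamond> x \<cdot> \<zero>) \<cdot> (\<diamond> y \<cdot> \<zero>)) \<cdot> \<diamond> x"
begin

definition filter_rel :: "('a set \<times> 'a set) set"
  where "filter_rel = {(\<alpha>, \<beta>) \<in> proper_filters \<times> proper_filters. dia ` \<alpha> \<subseteq> \<beta>}"

end

definition perp_set :: "'b set \<Rightarrow> ('b \<times> 'b) set \<Rightarrow> 'b set \<Rightarrow> 'b set"
  where "perp_set X P U = {y \<in> X. \<forall>u\<in>U. (y, u) \<in> P}"

locale monadic_orthoframe =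
  fixes X :: "'b set" and P R :: "('b \<times> 'b) set"
  assumes P_on: "P \<subseteq> X \<times> X"
    and P_irrefl: "irrefl P"
    and P_sym: "sym P"
    and R_on: "R \<subseteq> X \<times> X"
    and R_refl: "refl_on X R"
    and R_trans: "trans R"
    and R_perp: "x \<in> X \<Longrightarrow> R `` perp_set X P (R `` {x}) \<subseteq> perp_set X P (R `` {x})"

end

theory Submission
  imports Defs
begin

text \<open>Put \<open>x \<le> y\<close> iff \<open>x \<cdot> y = 1\<close>. This is a partial order in which \<open>x \<cdot> 0\<close> is an
  order-reversing involution and \<open>((x \<cdot> y) \<cdot> (x \<cdot> 0)) \<cdot> 0\<close> is the meet of \<open>x\<close> and \<open>y\<close>. The only
  substantial frame condition is the last one. Given a proper filter \<open>\<alpha>\<close>, the up-set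
  \<open>\<delta>\<close> of \<open>\<diamond>[\<alpha>]\<close> is again a proper filter, because \<open>\<diamond>(x \<and> y) \<le> \<diamond>x \<and> \<diamond>y\<close>, and it is the
  least \<open>R\<close>-successor of \<open>\<alpha>\<close>. If \<open>\<beta>\<close> is orthogonal to all successors of \<open>\<alpha>\<close>, it
  is so to \<open>\<delta>\<close>, which puts some \<open>\<diamond>x \<cdot> 0\<close> with \<open>x \<in> \<alpha>\<close> into \<open>\<beta>\<close>. This element is fixed by \<open>\<diamond>\<close>,
  hence lies in every successor of \<open>\<beta>\<close>, while \<open>\<diamond>x\<close> lies in every successor of \<open>\<alpha>\<close>.\<close>

section \<open>The order defined by the implication\<close>

context quasi_implication_algebra
begin

lemma one_closed: "x \<in> A \<Longrightarrow> \<one> \<in> A"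
  using imp_closed self_imp by metis

lemma one_imp: "x \<in> A \<Longrightarrow> \<one> \<cdot> x = x"
  using QI1 self_imp by metis

lemma imp_contract: "\<lbrakk>x \<in> A; y \<in> A\<rbrakk> \<Longrightarrow> x \<cdot> (x \<cdot> y) = x \<cdot> y"
  using QI1 imp_closed by metis

lemma imp_one: "x \<in> A \<Longrightarrow> x \<cdot> \<one> = \<one>"
  using imp_contract self_imp by metis

text \<open>Both sides of \<open>QI3\<close> collapse, to \<open>x\<close> and to
  \<open>y\<close>.\<close>

lemma imp_antisym: "\<lbrakk>x \<in> A; y \<in> A; x \<cdot> y = \<one>; y \<cdot> x = \<one>\<rbrakk> \<Longrightarrow> x = y"
  using QI3[of x y] one_closed one_imp by simp

text \<open>In \<open>QI2\<close>, \<open>x \<le> y\<close> reduces the left side to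
  \<open>x \<cdot> z\<close>, and \<open>y \<le> z\<close> reduces the right side to
  \<open>\<one>\<close>.\<close>

lemma imp_trans:
  assumes "x \<in> A" "y \<in> A" "z \<in> A" "x \<cdot> y = \<one>" "y \<cdot> z = \<one>"
  shows "x \<cdot> z = \<one>"
  using QI2[of x y z] assms by (simp add: one_imp imp_one imp_closed)

lemma imp_mono_right:
  assumes "x \<in> A" "y \<in> A" "z \<in> A" "y \<cdot> z = \<one>"
  shows "(x \<cdot> y) \<cdot> (x \<cdot> z) = \<one>"
  using QI2[of x y z] assms by (simp add: imp_one imp_closed)

lemma imp_weaken:
  assumes "x \<in> A" "y \<in> A" "x \<cdot> y = \<one>"
  shows "x \<cdot> (y \<cdot> x) = \<one>"
  using QI2[of x y "y \<cdot> x"] assms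
  by (simp add: imp_closed imp_contract one_imp self_imp)

text \<open>Without the lower bound \<open>a \<le> u\<close> the operation is not antitone in its first argument.\<close>

lemma imp_antimono_left:
  assumes "a \<in> A" "u \<in> A" "v \<in> A" "a \<cdot> u = \<one>" "u \<cdot> v = \<one>"
  shows "(v \<cdot> a) \<cdot> (u \<cdot> a) = \<one>"
proof -
  have "u \<cdot> a = (v \<cdot> u) \<cdot> (v \<cdot> a)"
    using QI2[of u v a] assms by (simp add: one_imp imp_closed)
  \<comment> \<open>Here the lower bound \<open>a \<le> u\<close> enters: \<open>imp_weaken\<close>
    needs \<open>v \<cdot> a\<close> below \<open>v \<cdot> u\<close>.\<close>
  moreover have "(v \<cdot> a) \<cdot> (v \<cdot> u) = \<one>"
    using assms by (simp add: imp_mono_right)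
  ultimately show ?thesis
    using assms by (simp add: imp_weaken imp_closed)
qed

end

section \<open>Orthocomplement, meets and joins\<close>

context bounded_quasi_implication_algebra
begin

lemma compl_closed: "x \<in> A \<Longrightarrow> x \<cdot> \<zero> \<in> A"
  by (simp add: imp_closed zero_closed)

text \<open>In \<open>QI3\<close> with \<open>y = \<zero>\<close>, the left side becomes
  \<open>x\<close> and the right side its double complement.\<close>

lemma compl_compl:
  assumes "x \<in> A"
  shows "(x \<cdot> \<zero>) \<cdot> \<zero> = x"
  using QI3[of x \<zero>] assms by (simp add: zero_imp zero_closed imp_one one_imp imp_closed)

lemma compl_le_imp:
  assumes "x \<in> A" "y \<in> A"
  shows "(x \<cdot> \<zero>) \<cdot> (x \<cdot> y) = \<one>"
  using assms by (simp add: imp_mono_right zero_closed zero_imp)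

lemma compl_antimono:
  assumes "x \<in> A" "y \<in> A" "x \<cdot> y = \<one>"
  shows "(y \<cdot> \<zero>) \<cdot> (x \<cdot> \<zero>) = \<one>"
  using assms by (simp add: imp_antimono_left zero_closed zero_imp)

definition meet :: "'a \<Rightarrow> 'a \<Rightarrow> 'a"
  where "meet x y = ((x \<cdot> y) \<cdot> (x \<cdot> \<zero>)) \<cdot> \<zero>"

lemma meet_closed: "\<lbrakk>x \<in> A; y \<in> A\<rbrakk> \<Longrightarrow> meet x y \<in> A"
  by (simp add: meet_def imp_closed zero_closed)

text \<open>Symmetry is \<open>QI2\<close> with third argument \<open>\<zero>\<close>.\<close>

lemma meet_commute: "\<lbrakk>x \<in> A; y \<in> A\<rbrakk> \<Longrightarrow> meet x y = meet y x"
  by (simp add: meet_def QI2[of x y] zero_closed)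

lemma meet_le1:
  assumes "x \<in> A" "y \<in> A"
  shows "meet x y \<cdot> x = \<one>"
proof -
  have "(x \<cdot> \<zero>) \<cdot> ((x \<cdot> y) \<cdot> (x \<cdot> \<zero>)) = \<one>"
    using assms by (simp add: imp_weaken compl_le_imp imp_closed zero_closed)
  from compl_antimono[OF _ _ this] show ?thesis
    using assms by (simp add: meet_def compl_compl imp_closed zero_closed)
qed

lemma meet_le2: "\<lbrakk>x \<in> A; y \<in> A\<rbrakk> \<Longrightarrow> meet x y \<cdot> y = \<one>"
  using meet_le1 meet_commute by metis

lemma le_meet:
  assumes "x \<in> A" "y \<in> A" "z \<in> A" "z \<cdot> x = \<one>" "z \<cdot> y = \<one>"
  shows "z \<cdot> meet x y = \<one>"
proof -
  \<comment> \<open>Since \<open>z \<le> x\<close>, this says that \<open>meet x z\<close> is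
    \<open>z\<close>, so it remains to compare \<open>meet x z\<close> with
    \<open>meet x y\<close>.\<close>
  have "(x \<cdot> z) \<cdot> (x \<cdot> \<zero>) = z \<cdot> \<zero>"
    using QI2[of x z \<zero>] assms by (simp add: zero_closed one_imp imp_closed)
  \<comment> \<open>The lower bound for \<open>imp_antimono_left\<close> is
    \<open>x \<cdot> \<zero>\<close>, which lies below \<open>x \<cdot> z\<close>.\<close>
  moreover have "((x \<cdot> y) \<cdot> (x \<cdot> \<zero>)) \<cdot> ((x \<cdot> z) \<cdot> (x \<cdot> \<zero>)) = \<one>"
    using assms
    by (simp add: imp_antimono_left imp_closed zero_closed compl_le_imp imp_mono_right)
  ultimately have "((x \<cdot> y) \<cdot> (x \<cdot> \<zero>)) \<cdot> (z \<cdot> \<zero>) = \<one>"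
    by simp
  from compl_antimono[OF _ _ this] show ?thesis
    using assms by (simp add: meet_def compl_compl imp_closed zero_closed)
qed

text \<open>This is the term in \<open>dia_join\<close>; \<open>join_eq\<close> identifies it as the
  De Morgan dual of \<open>meet\<close>.\<close>

definition join :: "'a \<Rightarrow> 'a \<Rightarrow> 'a"
  where "join x y = ((x \<cdot> \<zero>) \<cdot> (y \<cdot> \<zero>)) \<cdot> x"

lemma join_eq:
  "\<lbrakk>x \<in> A; y \<in> A\<rbrakk> \<Longrightarrow> join x y = meet (x \<cdot> \<zero>) (y \<cdot> \<zero>) \<cdot> \<zero>"
  by (simp add: join_def meet_def compl_compl imp_closed zero_closed)

lemma le_join1:
  assumes "x \<in> A" "y \<in> A"
  shows "x \<cdot> join x y = \<one>"
proof -
  have "((x \<cdot> \<zero>) \<cdot> \<zero>) \<cdot> (meet (x \<cdot> \<zero>) (y \<cdot> \<zero>) \<cdot> \<zero>) = \<one>"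
    using assms by (intro compl_antimono meet_le1 meet_closed compl_closed)
  then show ?thesis
    using assms by (simp only: join_eq compl_compl)
qed

lemma join_absorb:
  assumes "x \<in> A" "y \<in> A" "x \<cdot> y = \<one>"
  shows "join x y = y"
proof -
  have "meet (x \<cdot> \<zero>) (y \<cdot> \<zero>) = y \<cdot> \<zero>"
  proof (rule imp_antisym)
    show "(y \<cdot> \<zero>) \<cdot> meet (x \<cdot> \<zero>) (y \<cdot> \<zero>) = \<one>"
      using assms by (intro le_meet compl_antimono self_imp compl_closed)
  qed (use assms in \<open>simp_all only: meet_closed meet_le2 compl_closed\<close>)
  then show ?thesis
    using assms by (simp only: join_eq compl_compl)
qed

section \<open>Filters and orthogonality\<close>

lemma filters_subset: "\<alpha> \<in> filters \<Longrightarrow> x \<in> \<alpha> \<Longrightarrow> x \<in> A"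
  by (auto simp: filters_def)

lemma filters_upward: "\<lbrakk>\<alpha> \<in> filters; x \<in> \<alpha>; y \<in> A; x \<cdot> y = \<one>\<rbrakk> \<Longrightarrow> y \<in> \<alpha>"
  by (auto simp: filters_def)

lemma filters_meet: "\<lbrakk>\<alpha> \<in> filters; x \<in> \<alpha>; y \<in> \<alpha>\<rbrakk> \<Longrightarrow> meet x y \<in> \<alpha>"
  by (auto simp: filters_def meet_def)

lemma proper_filtersD: "\<alpha> \<in> proper_filters \<Longrightarrow> \<alpha> \<in> filters"
  by (simp add: proper_filters_def)

text \<open>The meet of \<open>x\<close> and its complement is \<open>\<zero>\<close>. This yields
  irreflexivity of orthogonality.\<close>

lemma proper_filters_consistent:
  assumes "\<alpha> \<in> proper_filters" "x \<in> \<alpha>"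
  shows "x \<cdot> \<zero> \<notin> \<alpha>"
proof
  assume "x \<cdot> \<zero> \<in> \<alpha>"
  moreover have "x \<in> A"
    using assms filters_subset proper_filtersD by blast
  then have "meet x (x \<cdot> \<zero>) = \<zero>"
    by (simp add: meet_def imp_contract self_imp one_imp compl_closed zero_closed)
  ultimately show False
    using assms filters_meet[of \<alpha> x "x \<cdot> \<zero>"] by (simp add: proper_filters_def)
qed

lemma irrefl_filter_perp: "irrefl filter_perp"
  by (auto simp: irrefl_def filter_perp_def dest: proper_filters_consistent)

lemma sym_filter_perp: "sym filter_perp"
proof (rule symI)
  fix \<alpha> \<beta> assume "(\<alpha>, \<beta>) \<in> filter_perp"
  then obtain x where "\<alpha> \<in> proper_filters" "\<beta> \<in> proper_filters"
    and x: "x \<in> A" "x \<in> \<alpha>" "x \<cdot> \<zero> \<in> \<beta>"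
    by (auto simp: filter_perp_def)
  \<comment> \<open>As complementation is an involution, \<open>x \<cdot> \<zero>\<close> is a
    witness for the reversed pair.\<close>
  then show "(\<beta>, \<alpha>) \<in> filter_perp"
    using compl_closed[of x] compl_compl[of x]
    by (auto simp: filter_perp_def intro!: bexI[of _ "x \<cdot> \<zero>"])
qed

end

section \<open>The operator and the accessibility relation\<close>

context monadic_quasi_implication_algebra
begin

text \<open>If \<open>x \<le> y\<close>, their join is \<open>y\<close>, so \<open>dia_join\<close>
  exhibits \<open>\<diamond> y\<close> as a join with \<open>\<diamond> x\<close>.\<close>

lemma dia_mono:
  assumes "x \<in> A" "y \<in> A" "x \<cdot> y = \<one>"
  shows "\<diamond> x \<cdot> \<diamond> y = \<one>"
proof -
  have "\<diamond> y = join (\<diamond> x) (\<diamond> y)"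
    using dia_join[of x y] join_absorb[of x y] assms by (simp add: join_def)
  then show ?thesis
    using le_join1[of "\<diamond> x" "\<diamond> y"] assms by (simp add: dia_closed)
qed

lemma refl_filter_rel: "refl_on proper_filters filter_rel"
proof (rule refl_onI)
  fix \<alpha> assume \<alpha>: "\<alpha> \<in> proper_filters"
  have "\<diamond> x \<in> \<alpha>" if "x \<in> \<alpha>" for x
    using \<alpha> that filters_subset filters_upward proper_filtersD dia_closed imp_dia by metis
  with \<alpha> show "(\<alpha>, \<alpha>) \<in> filter_rel"
    by (auto simp: filter_rel_def)
qed

lemma trans_filter_rel: "trans filter_rel"
proof (rule transI)
  fix \<alpha> \<beta> \<gamma> assume "(\<alpha>, \<beta>) \<in> filter_rel" "(\<beta>, \<gamma>) \<in> filter_rel"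
  then have F: "\<alpha> \<in> proper_filters" "\<gamma> \<in> proper_filters"
    and dia: "\<And>x. x \<in> \<alpha> \<Longrightarrow> \<diamond> \<diamond> x \<in> \<gamma>"
    by (auto simp: filter_rel_def)
  have "\<diamond> x \<in> \<gamma>" if "x \<in> \<alpha>" for x
  proof -
    have "x \<in> A"
      using F that filters_subset proper_filtersD by blast
    then show ?thesis
      using F dia[OF that] filters_upward proper_filtersD dia_closed dia_dia by blast
  qed
  then show "(\<alpha>, \<gamma>) \<in> filter_rel"
    using F by (auto simp: filter_rel_def)
qed

definition dia_filter :: "'a set \<Rightarrow> 'a set"
  where "dia_filter \<alpha> = {u \<in> A. \<exists>x\<in>\<alpha>. \<diamond> x \<cdot> u = \<one>}"

lemma dia_filter_in_filters:
  assumes "\<alpha> \<in> filters"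
  shows "dia_filter \<alpha> \<in> filters"
proof -
  note sub = filters_subset[OF assms]
  have "dia_filter \<alpha> \<noteq> {}"
    using assms sub dia_closed self_imp by (fastforce simp: filters_def dia_filter_def)
  moreover have "v \<in> dia_filter \<alpha>" if "u \<in> dia_filter \<alpha>" "v \<in> A" "u \<cdot> v = \<one>" for u v
    using that sub by (auto simp: dia_filter_def intro: imp_trans dia_closed)
  moreover have "meet u v \<in> dia_filter \<alpha>"
    if uv: "u \<in> dia_filter \<alpha>" "v \<in> dia_filter \<alpha>" for u v
  proof -
    obtain x y where xy: "x \<in> \<alpha>" "y \<in> \<alpha>" "\<diamond> x \<cdot> u = \<one>" "\<diamond> y \<cdot> v = \<one>" "u \<in> A" "v \<in> A"
      using uv by (auto simp: dia_filter_def)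
    then have A: "x \<in> A" "y \<in> A" "meet x y \<in> A"
      using sub meet_closed by auto
    then have "\<diamond> (meet x y) \<cdot> \<diamond> x = \<one>" "\<diamond> (meet x y) \<cdot> \<diamond> y = \<one>"
      by (simp_all add: dia_mono meet_le1 meet_le2)
    then have "\<diamond> (meet x y) \<cdot> u = \<one>" "\<diamond> (meet x y) \<cdot> v = \<one>"
      using A xy imp_trans dia_closed by blast+
    then have "\<diamond> (meet x y) \<cdot> meet u v = \<one>"
      using A xy by (simp add: le_meet dia_closed)
    then show ?thesis
      using filters_meet[OF assms xy(1,2)] xy by (auto simp: dia_filter_def meet_closed)
  qed
  ultimately show ?thesis
    by (auto simp: filters_def meet_def dia_filter_def)
qed

text \<open>From \<open>\<diamond> x \<le> \<zero>\<close> and \<open>x \<le> \<diamond> x\<close>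
  follows \<open>x \<le> \<zero>\<close>, which would put \<open>\<zero>\<close> into
  \<alpha>.\<close>

lemma dia_filter_proper:
  assumes "\<alpha> \<in> proper_filters"
  shows "dia_filter \<alpha> \<in> proper_filters"
proof -
  have F: "\<alpha> \<in> filters"
    using assms by (rule proper_filtersD)
  have "\<zero> \<notin> dia_filter \<alpha>"
  proof
    assume "\<zero> \<in> dia_filter \<alpha>"
    then obtain x where x: "x \<in> \<alpha>" "\<diamond> x \<cdot> \<zero> = \<one>"
      by (auto simp: dia_filter_def)
    then have "x \<cdot> \<zero> = \<one>"
      using F filters_subset imp_trans dia_closed imp_dia zero_closed by blast
    then show False
      using assms F x filters_upward zero_closed by (auto simp: proper_filters_def)
  qed
  then show ?thesis
    using F by (simp add: proper_filters_def dia_filter_in_filters)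
qed

lemma filter_rel_dia_filter:
  assumes "\<alpha> \<in> proper_filters"
  shows "(\<alpha>, dia_filter \<alpha>) \<in> filter_rel"
proof -
  have "\<diamond> x \<in> dia_filter \<alpha>" if "x \<in> \<alpha>" for x
  proof -
    have "\<diamond> x \<in> A"
      using assms that filters_subset proper_filtersD dia_closed by blast
    with that show ?thesis
      using self_imp by (auto simp: dia_filter_def)
  qed
  then show ?thesis
    using assms dia_filter_proper by (auto simp: filter_rel_def)
qed

text \<open>Orthogonality gives some \<open>u\<close> in \<beta> with
  \<open>\<diamond> x \<le> u \<cdot> \<zero>\<close>. Complementing,
  \<open>u \<le> \<diamond> x \<cdot> \<zero>\<close>, an element of the form to which
  \<open>dia_compl\<close> applies.\<close>

lemma filter_perp_dia_filterD:
  assumes "(\<beta>, dia_filter \<alpha>) \<in> filter_perp" "\<alpha> \<in> proper_filters"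
  obtains x where "x \<in> \<alpha>" "\<diamond> x \<cdot> \<zero> \<in> \<beta>"
proof -
  obtain u x where F: "\<beta> \<in> filters" and u: "u \<in> A" "u \<in> \<beta>"
    and x: "x \<in> \<alpha>" "\<diamond> x \<cdot> (u \<cdot> \<zero>) = \<one>"
    using assms by (auto simp: filter_perp_def dia_filter_def dest: proper_filtersD)
  have "\<diamond> x \<in> A"
    using assms x filters_subset proper_filtersD dia_closed by blast
  then have "u \<cdot> (\<diamond> x \<cdot> \<zero>) = \<one>"
    using compl_antimono[OF _ _ x(2)] u by (simp add: compl_closed compl_compl)
  then have "\<diamond> x \<cdot> \<zero> \<in> \<beta>"
    using F u \<open>\<diamond> x \<in> A\<close> filters_upward compl_closed by blast
  with x(1) show thesis
    by (rule that)
qed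

lemma filter_rel_perp:
  assumes \<alpha>: "\<alpha> \<in> proper_filters"
  shows "filter_rel `` perp_set proper_filters filter_perp (filter_rel `` {\<alpha>})
    \<subseteq> perp_set proper_filters filter_perp (filter_rel `` {\<alpha>})"
proof
  fix \<gamma> assume "\<gamma> \<in> filter_rel `` perp_set proper_filters filter_perp (filter_rel `` {\<alpha>})"
  then obtain \<beta> where \<beta>: "\<beta> \<in> perp_set proper_filters filter_perp (filter_rel `` {\<alpha>})"
    and \<beta>\<gamma>: "(\<beta>, \<gamma>) \<in> filter_rel"
    by blast
  have "(\<beta>, dia_filter \<alpha>) \<in> filter_perp"
    using \<beta> filter_rel_dia_filter[OF \<alpha>] by (auto simp: perp_set_def)
  then obtain x where x: "x \<in> \<alpha>" "\<diamond> x \<cdot> \<zero> \<in> \<beta>"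
    using \<alpha> by (rule filter_perp_dia_filterD)
  have A: "x \<in> A"
    using \<alpha> x filters_subset proper_filtersD by blast
  have "\<diamond> (\<diamond> x \<cdot> \<zero>) \<in> \<gamma>"
    using \<beta>\<gamma> x by (auto simp: filter_rel_def)
  then have \<gamma>: "\<diamond> x \<cdot> \<zero> \<in> \<gamma>"
    using A by (simp add: dia_compl)
  have "(\<gamma>, \<delta>) \<in> filter_perp" if "(\<alpha>, \<delta>) \<in> filter_rel" for \<delta>
  proof -
    have "\<diamond> x \<in> \<delta>"
      using that x by (auto simp: filter_rel_def)
    \<comment> \<open>The witness is \<open>\<diamond> x\<close>; since its complement is the
      element in \<gamma>, the pair comes out reversed.\<close>
    then have "(\<delta>, \<gamma>) \<in> filter_perp"
      using that \<beta>\<gamma> \<gamma> dia_closed[OF A] by (auto simp: filter_rel_def filter_perp_def)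
    then show ?thesis
      by (rule symD[OF sym_filter_perp])
  qed
  then show "\<gamma> \<in> perp_set proper_filters filter_perp (filter_rel `` {\<alpha>})"
    using \<beta>\<gamma> by (auto simp: perp_set_def filter_rel_def)
qed

end

theorem theorem5p9:
  fixes A :: "'a set"
    and imp :: "'a \<Rightarrow> 'a \<Rightarrow> 'a"
    and zero :: "'a"
    and dia :: "'a \<Rightarrow> 'a"
  assumes "monadic_quasi_implication_algebra A imp zero dia"
  shows "monadic_orthoframe
    (bounded_quasi_implication_algebra.proper_filters A imp zero)
    (bounded_quasi_implication_algebra.filter_perp A imp zero)
    (monadic_quasi_implication_algebra.filter_rel A imp zero dia)"
proof -
  interpret monadic_quasi_implication_algebra A imp zero dia
    by (fact assms)
  show ?thesis
  proof
    show "filter_perp \<subseteq> proper_filters \<times> proper_filters"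
      by (auto simp: filter_perp_def)
    show "filter_rel \<subseteq> proper_filters \<times> proper_filters"
      by (auto simp: filter_rel_def)
  qed (fact irrefl_filter_perp sym_filter_perp refl_filter_rel trans_filter_rel
      filter_rel_perp)+
qed

end
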